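(* (Optimality hierarchy.) Let $F=f+h-g$ satisfy the standing assumptions in the context, let $\theta\ge0$, and assume that $z(x)\triangleq-g(x)$ is locally $\rho$-bounded nonconvex (with $\rho<+\infty$) at every coordinate-wise stationary point $\ddot x$. Let $\{\bar x\}$, $\{\ddot x\}$, $\{\grave x\}$, $\{\check x\}$ denote respectively the sets of all optimal points (global minimizers of $F$), coordinate-wise stationary points, directional points, and critical points of the problem $\min_{x\in\mathbb{R}^n}F(x)$. Then $$\{\bar x\}\subseteq\{\ddot x\}\subseteq\{\grave x\}\subseteq\{\check x\}.$$
   Context: Notation: $e_i\in\mathbb{R}^n$ is the $i$-th standard basis vector; $\partial$ denotes the convex subdifferential; $F'(x;d)\triangleq\lim_{t\downarrow0}\frac1t(F(x+td)-F(x))$. Standing assumptions. (i) $f:\mathbb{R}^n\to\mathbb{R}$ is convex and continuously differentiable, and there is a vector $c\in\mathbb{R}^n$ with $c_i\ge 0$ such that $f(x+\eta e_i)\le f(x)+\langle\nabla f(x),\eta e_i\rangle+\frac{c_i}{2}\eta^2$ for all $x\in\mathbb{R}^n$, $\eta\in\mathbb{R}$, $i=1,\dots,n$. (ii) $h$ is convex and coordinate-wise separable: $h(x)=\sum_{i=1}^nh_i(x_i)$. (iii) $g:\mathbb{R}^n\to\mathbb{R}$ is convex (not necessarily differentiable or separable), and the one-dimensional problems $\min_{\eta\in\mathbb{R}}\frac a2\eta^2+b\eta+h_i(x_i+\eta)-g(x+\eta e_i)$ can be solved exactly (global minimizers exist and can be computed) for given $a\ge0$, $b\in\mathbb{R}$,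 $i$. (iv) $F=f+h-g$ takes only finite values. Coordinate-wise stationary point: for the constant $\theta\ge0$, set $\mathcal{M}_i(x,\eta)\triangleq f(x)+\langle\nabla f(x),\eta e_i\rangle+\frac{c_i}{2}\eta^2+h_i(x_i+\eta)-g(x+\eta e_i)+\frac\theta2\eta^2$. A point $\ddot x$ is a coordinate-wise stationary point if $0\in\arg\min_{\eta\in\mathbb{R}}\mathcal{M}_i(\ddot x,\eta)$ for all $i=1,\dots,n$. Directional point: $\grave x$ such that $F'(\grave x;y-\grave x)\ge0$ for all $y\in\mathrm{dom}(F)\triangleq\{x:|F(x)|<+\infty\}$. Critical point: $\check x$ such that $0\in\nabla f(\check x)+\partial h(\check x)-\partial g(\check x)$. Locally $\rho$-bounded nonconvexity: $z=-g$ is locally $\rho$-bounded nonconvex at $\ddot x$, with $\rho<+\infty$, if for all $y\in\mathbb{R}^n$: $z(\ddot x)\le z(y)+\langle\ddot x-y,\partial z(\ddot x)\rangle+\frac\rho2\|\ddot x-y\|_2^2$, i.e. $-g(\ddot x)\le -g(y)-\langle\ddot x-y,\xi\rangle+\frac\rho2\|\ddot x-y\|_2^2$ for $\xi\in\partial g(\ddot x)$. *)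

theory Defs
  imports "HOL-Analysis.Analysis"
begin

definition subdifferential :: "('a::real_inner \<Rightarrow> real) \<Rightarrow> 'a \<Rightarrow> 'a set" where
  "subdifferential \<phi> x = {\<xi>. \<forall>y. \<phi> y \<ge> \<phi> x + \<xi> \<bullet> (y - x)}"

definition has_dir_deriv :: "('a::real_normed_vector \<Rightarrow> real) \<Rightarrow> 'a \<Rightarrow> 'a \<Rightarrow> real \<Rightarrow> bool" where
  "has_dir_deriv F x d D \<longleftrightarrow>
     ((\<lambda>t. (F (x + t *\<^sub>R d) - F x) / t) \<longlongrightarrow> D) (at_right 0)"

text \<open>
  In the next definition the concave function \<open>z = - g\<close> is described through the convex
  function \<open>g\<close>: the subdifferential of \<open>z\<close> is understood as \<open>- subdifferential g\<close>,
  and the inequality is required for each of its elements.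
\<close>

definition loc_bounded_nonconvex_neg ::
    "('a::real_inner \<Rightarrow> real) \<Rightarrow> real \<Rightarrow> 'a \<Rightarrow> bool" where
  "loc_bounded_nonconvex_neg g \<rho> x \<longleftrightarrow>
     (\<forall>y. \<forall>\<xi>\<in>subdifferential g x.
        - g x \<le> - g y - (x - y) \<bullet> \<xi> + \<rho> / 2 * (norm (x - y))\<^sup>2)"

text \<open>
  \<open>hs i\<close> is the \<open>i\<close>-th summand of the separable function \<open>h\<close>, \<open>gradf\<close> is the
  gradient of \<open>f\<close>, and \<open>axis i 1\<close> is the \<open>i\<close>-th standard basis vector.
\<close>

definition subproblem ::
    "('n::finite \<Rightarrow> real \<Rightarrow> real) \<Rightarrow> (real ^ 'n \<Rightarrow> real) \<Rightarrow> real \<Rightarrow> real \<Rightarrow> real ^ 'n \<Rightarrow> 'n \<Rightarrow> real \<Rightarrow> real"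
  where
  "subproblem hs g a b x i \<eta> =
     a / 2 * \<eta>\<^sup>2 + b * \<eta> + hs i (x $ i + \<eta>) - g (x + \<eta> *\<^sub>R axis i 1)"

definition coord_model ::
    "(real ^ 'n \<Rightarrow> real) \<Rightarrow> (real ^ 'n \<Rightarrow> real ^ 'n) \<Rightarrow> real ^ 'n \<Rightarrow> ('n::finite \<Rightarrow> real \<Rightarrow> real) \<Rightarrow>
     (real ^ 'n \<Rightarrow> real) \<Rightarrow> real \<Rightarrow> 'n \<Rightarrow> real ^ 'n \<Rightarrow> real \<Rightarrow> real" where
  "coord_model f gradf c hs g \<theta> i x \<eta> =
     f x + gradf x \<bullet> (\<eta> *\<^sub>R axis i 1) + c $ i / 2 * \<eta>\<^sup>2
     + hs i (x $ i + \<eta>) - g (x + \<eta> *\<^sub>R axis i 1) + \<theta> / 2 * \<eta>\<^sup>2"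

definition optimal_points :: "('a \<Rightarrow> real) \<Rightarrow> 'a set" where
  "optimal_points F = {x. is_arg_min F (\<lambda>_. True) x}"

definition coord_stationary_points ::
    "(real ^ 'n \<Rightarrow> real) \<Rightarrow> (real ^ 'n \<Rightarrow> real ^ 'n) \<Rightarrow> real ^ 'n \<Rightarrow> ('n::finite \<Rightarrow> real \<Rightarrow> real) \<Rightarrow>
     (real ^ 'n \<Rightarrow> real) \<Rightarrow> real \<Rightarrow> (real ^ 'n) set" where
  "coord_stationary_points f gradf c hs g \<theta> =
     {x. \<forall>i. is_arg_min (coord_model f gradf c hs g \<theta> i x) (\<lambda>_. True) 0}"

text \<open>
  The objective is real-valued, so its effective domain is the whole space and the direction
  \<open>y - x\<close> below ranges over all \<open>y\<close>. The directional derivative is required to exist.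
\<close>

definition directional_points :: "('a::real_normed_vector \<Rightarrow> real) \<Rightarrow> 'a set" where
  "directional_points F = {x. \<forall>y. \<exists>D. has_dir_deriv F x (y - x) D \<and> D \<ge> 0}"

text \<open>The difference of subdifferentials is the Minkowski one, not set difference.\<close>

definition critical_points ::
    "('a::real_inner \<Rightarrow> 'a) \<Rightarrow> ('a \<Rightarrow> real) \<Rightarrow> ('a \<Rightarrow> real) \<Rightarrow> 'a set" where
  "critical_points gradf h g =
     {x. 0 \<in> {gradf x + u - v |u v. u \<in> subdifferential h x \<and> v \<in> subdifferential g x}}"

end

theory Submission
  imports Defs
begin

text \<open>
  Let \<open>x\<close> be a point and \<open>\<xi>\<close> a subgradient of \<open>g\<close> at \<open>x\<close>; one exists because
  \<open>g\<close> is finite and convex on a finite-dimensional space (\<open>subdifferential_nonempty\<close>). The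
  last two inclusions rest on comparing \<open>g\<close> with its affine minorant
  \<open>y \<mapsto> g x + \<xi> \<bullet> (y - x)\<close>; replacing \<open>g\<close> by it turns \<open>F\<close> into a convex function.

  Optimal points are coordinate-wise stationary since the coordinate model majorises \<open>F\<close> along
  the \<open>i\<close>-th axis, up to a constant, and touches it at step \<open>0\<close>.

  At a coordinate-wise stationary point the affine minorant of \<open>g\<close> turns the optimality of the
  step \<open>0\<close> into a lower bound on each \<open>hs i\<close> by a line of slope \<open>\<xi> $ i - gradf x $ i\<close> minus a
  quadratic. For convex functions the quadratic is immaterial
  (\<open>subgradient_if_quadratic_lower_bound\<close>), so these slopes are subgradients of the \<open>hs i\<close>, and
  separability assembles them to \<open>\<xi> - gradf x \<in> subdifferential h x\<close>. Hence the one-sided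
  derivative of \<open>h\<close> in direction \<open>d\<close>, which exists by monotonicity of difference quotients, is at
  least \<open>(\<xi> - gradf x) \<bullet> d\<close>. Bounded nonconvexity squeezes \<open>g\<close> between its affine minorant and
  that minorant plus a quadratic, so the derivative of \<open>g\<close> is exactly \<open>\<xi> \<bullet> d\<close>. The three
  derivatives add up to a nonnegative number.

  At a directional point, the difference quotient of \<open>F\<close> over steps in \<open>(0, 1]\<close> is bounded above
  by that of \<open>f\<close> plus \<open>h (x + d) - h x - \<xi> \<bullet> d\<close>. Passing to the limit shows again
  \<open>\<xi> - gradf x \<in> subdifferential h x\<close>, which is criticality.
\<close>

section \<open>Subgradients of convex functions\<close>

lemma convex_strict_epigraph:
  fixes \<phi> :: "'a::real_vector \<Rightarrow> real"
  assumes "convex_on UNIV \<phi>"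
  shows "convex {p. \<phi> (fst p) < snd p}"
proof (rule convexI)
  fix p q :: "'a \<times> real" and u v :: real
  assume p: "p \<in> {p. \<phi> (fst p) < snd p}" and q: "q \<in> {p. \<phi> (fst p) < snd p}"
    and uv: "0 \<le> u" "0 \<le> v" "u + v = 1"
  have "\<phi> (u *\<^sub>R fst p + v *\<^sub>R fst q) \<le> u * \<phi> (fst p) + v * \<phi> (fst q)"
    using convex_onD[OF assms, of v "fst p" "fst q"] uv by (simp add: eq_diff_eq[symmetric])
  also have "\<dots> < u * snd p + v * snd q"
  proof (cases "u = 0")
    case True
    then show ?thesis using uv q by simp
  next
    case False
    then have "u * \<phi> (fst p) < u * snd p" using uv p by simp
    moreover have "v * \<phi> (fst q) \<le> v * snd q" using uv q by (simp add: mult_left_mono)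
    ultimately show ?thesis by simp
  qed
  finally show "u *\<^sub>R p + v *\<^sub>R q \<in> {p. \<phi> (fst p) < snd p}" by simp
qed

text \<open>
  A hyperplane separates the graph point at \<open>x\<close> from the strict epigraph. It is not vertical,
  because the epigraph projects onto the whole space, and its slope is a subgradient.
\<close>

lemma subdifferential_nonempty:
  fixes \<phi> :: "'a::euclidean_space \<Rightarrow> real"
  assumes "convex_on UNIV \<phi>"
  shows "subdifferential \<phi> x \<noteq> {}"
proof -
  let ?E = "{p. \<phi> (fst p) < snd p}"
  have "?E \<noteq> {}"
    by (auto intro!: exI[of _ x] exI[of _ "\<phi> x + 1"])
  then obtain a b where a: "a \<noteq> 0" and le: "a \<bullet> (x, \<phi> x) \<le> b"
    and ge: "\<And>p. p \<in> ?E \<Longrightarrow> b \<le> a \<bullet> p"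
    using separating_hyperplane_sets[of "{(x, \<phi> x)}" ?E] convex_strict_epigraph[OF assms]
    by auto
  obtain u \<alpha> where au: "a = (u, \<alpha>)" by (cases a)
  have sep: "u \<bullet> x + \<alpha> * \<phi> x \<le> u \<bullet> y + \<alpha> * r" if "\<phi> y < r" for y r
    using ge[of "(y, r)"] le that by (simp add: au)
  have "0 \<le> \<alpha>"
    using sep[of x "\<phi> x + 1"] by (simp add: algebra_simps)
  moreover have "\<alpha> \<noteq> 0"
  proof
    assume "\<alpha> = 0"
    then have "u \<bullet> x \<le> u \<bullet> (x - u)"
      using sep[of "x - u" "\<phi> (x - u) + 1"] by simp
    then have "u \<bullet> u \<le> 0"
      by (simp add: inner_diff_right)
    then have "u = 0"
      using inner_gt_zero_iff[of u] by linarith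
    then show False using a au \<open>\<alpha> = 0\<close> by (simp add: zero_prod_def)
  qed
  ultimately have pos: "0 < \<alpha>" by simp
  have "\<phi> x + (- u /\<^sub>R \<alpha>) \<bullet> (y - x) \<le> \<phi> y" for y
  proof (rule field_le_epsilon)
    fix e :: real assume "0 < e"
    then have "u \<bullet> x + \<alpha> * \<phi> x \<le> u \<bullet> y + \<alpha> * (\<phi> y + e)" by (intro sep) simp
    then show "\<phi> x + (- u /\<^sub>R \<alpha>) \<bullet> (y - x) \<le> \<phi> y + e"
      using pos by (simp add: field_simps inner_diff_right)
  qed
  then show ?thesis unfolding subdifferential_def by blast
qed

text \<open>
  Shrinking the step by a factor \<open>t\<close> shrinks the quadratic by \<open>t\<^sup>2\<close>, whereas convexity shrinks
  the increment of \<open>\<phi>\<close> at least by \<open>t\<close>; dividing by \<open>t\<close> and letting \<open>t\<close> tend to \<open>0\<close> removes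
  the quadratic.
\<close>

lemma subgradient_if_quadratic_lower_bound:
  fixes \<phi> :: "'a::real_inner \<Rightarrow> real"
  assumes conv: "convex_on UNIV \<phi>"
    and lower: "\<And>y. \<phi> x + \<xi> \<bullet> (y - x) \<le> \<phi> y + C * (norm (y - x))\<^sup>2"
  shows "\<xi> \<in> subdifferential \<phi> x"
proof -
  have "\<phi> x + \<xi> \<bullet> (y - x) \<le> \<phi> y" for y
  proof (rule tendsto_lowerbound)
    let ?b = "\<lambda>t. \<phi> y + t * (C * (norm (y - x))\<^sup>2)"
    show "(?b \<longlongrightarrow> \<phi> y) (at_right 0)"
      by (auto intro!: tendsto_eq_intros)
    have "\<phi> x + \<xi> \<bullet> (y - x) \<le> ?b t" if t: "0 < t" "t < 1" for t
    proof -
      have eq: "(1 - t) *\<^sub>R x + t *\<^sub>R y - x = t *\<^sub>R (y - x)"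
        by (simp add: algebra_simps)
      have "\<phi> x + t * (\<xi> \<bullet> (y - x))
          \<le> \<phi> ((1 - t) *\<^sub>R x + t *\<^sub>R y) + C * (t\<^sup>2 * (norm (y - x))\<^sup>2)"
        using lower[of "(1 - t) *\<^sub>R x + t *\<^sub>R y"] by (simp add: eq power_mult_distrib)
      also have "\<dots> \<le> (1 - t) * \<phi> x + t * \<phi> y + C * (t\<^sup>2 * (norm (y - x))\<^sup>2)"
        using convex_onD[OF conv, of t x y] t by simp
      finally have "t * (\<phi> x + \<xi> \<bullet> (y - x)) \<le> t * ?b t"
        by (simp add: algebra_simps power2_eq_square)
      then show ?thesis using t by simp
    qed
    then show "\<forall>\<^sub>F t in at_right 0. \<phi> x + \<xi> \<bullet> (y - x) \<le> ?b t"
      unfolding eventually_at_right_field by (intro exI[of _ 1]) auto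
  qed simp
  then show ?thesis by (simp add: subdifferential_def)
qed

section \<open>Separable functions\<close>

lemma separable_coordinate_step:
  fixes h :: "real ^ 'n::finite \<Rightarrow> real"
  assumes sep: "\<And>x. h x = (\<Sum>i\<in>UNIV. hs i (x $ i))"
  shows "h (x + \<eta> *\<^sub>R axis i 1) = h x + hs i (x $ i + \<eta>) - hs i (x $ i)"
proof -
  have "(\<Sum>j\<in>UNIV - {i}. hs j ((x + \<eta> *\<^sub>R axis i 1) $ j)) = (\<Sum>j\<in>UNIV - {i}. hs j (x $ j))"
    by (rule sum.cong) (auto simp: axis_def)
  then show ?thesis
    by (simp add: sep sum.remove[of UNIV i])
qed

lemma convex_on_separable_summand:
  fixes h :: "real ^ 'n::finite \<Rightarrow> real"
  assumes conv: "convex_on UNIV h" and sep: "\<And>x. h x = (\<Sum>i\<in>UNIV. hs i (x $ i))"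
  shows "convex_on UNIV (hs i)"
proof (rule convex_onI)
  have hs_eq: "hs i s = h (s *\<^sub>R axis i 1) - h 0 + hs i 0" for s
    using separable_coordinate_step[where h = h and hs = hs and x = 0 and \<eta> = s and i = i, OF sep] by simp
  fix t r s :: real assume t: "0 < t" "t < 1"
  have "h (((1 - t) *\<^sub>R r + t *\<^sub>R s) *\<^sub>R axis i 1)
      \<le> (1 - t) * h (r *\<^sub>R axis i 1) + t * h (s *\<^sub>R axis i 1)"
    using convex_onD[OF conv, of t "r *\<^sub>R axis i 1" "s *\<^sub>R axis i 1"] t
    by (simp add: scaleR_left_distrib)
  then show "hs i ((1 - t) *\<^sub>R r + t *\<^sub>R s) \<le> (1 - t) * hs i r + t * hs i s"
    unfolding hs_eq[of "(1 - t) *\<^sub>R r + t *\<^sub>R s"] hs_eq[of r] hs_eq[of s]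
    by (simp add: algebra_simps)
qed simp

lemma subdifferential_separableI:
  fixes h :: "real ^ 'n::finite \<Rightarrow> real"
  assumes sep: "\<And>x. h x = (\<Sum>i\<in>UNIV. hs i (x $ i))"
    and sub: "\<And>i. \<xi> $ i \<in> subdifferential (hs i) (x $ i)"
  shows "\<xi> \<in> subdifferential h x"
proof -
  have "h x + \<xi> \<bullet> (y - x) \<le> h y" for y
    unfolding sep inner_vec_def sum.distrib[symmetric]
    using sub by (intro sum_mono) (simp add: subdifferential_def)
  then show ?thesis by (simp add: subdifferential_def)
qed

section \<open>One-sided directional derivatives\<close>

lemma has_dir_deriv_add:
  assumes "has_dir_deriv F x d A" "has_dir_deriv G x d B"
  shows "has_dir_deriv (\<lambda>y. F y + G y) x d (A + B)"
  using tendsto_add[OF assms[unfolded has_dir_deriv_def]]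
  by (simp add: has_dir_deriv_def add_divide_distrib[symmetric] algebra_simps)

lemma has_dir_deriv_diff:
  assumes "has_dir_deriv F x d A" "has_dir_deriv G x d B"
  shows "has_dir_deriv (\<lambda>y. F y - G y) x d (A - B)"
  using tendsto_diff[OF assms[unfolded has_dir_deriv_def]]
  by (simp add: has_dir_deriv_def diff_divide_distrib[symmetric] algebra_simps)

lemma has_dir_deriv_GDERIV:
  fixes f :: "'a::real_inner \<Rightarrow> real"
  assumes "GDERIV f x :> D"
  shows "has_dir_deriv f x d (D \<bullet> d)"
proof -
  have "((\<lambda>t. x + t *\<^sub>R d) has_derivative (\<lambda>t. t *\<^sub>R d)) (at 0)"
    by (auto intro!: derivative_eq_intros)
  moreover have "(f has_derivative (\<lambda>v. v \<bullet> D)) (at (x + 0 *\<^sub>R d))"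
    using assms by (simp add: gderiv_def)
  ultimately have "((\<lambda>t. f (x + t *\<^sub>R d)) has_derivative (\<lambda>t. (t *\<^sub>R d) \<bullet> D)) (at 0)"
    by (rule has_derivative_compose)
  then have "DERIV (\<lambda>t. f (x + t *\<^sub>R d)) 0 :> D \<bullet> d"
    by (simp add: has_field_derivative_def inner_commute mult.commute[of _ "D \<bullet> d"])
  then have "((\<lambda>t. (f (x + t *\<^sub>R d) - f x) / t) \<longlongrightarrow> D \<bullet> d) (at 0)"
    by (simp add: DERIV_def)
  then show ?thesis
    unfolding has_dir_deriv_def by (rule tendsto_mono[rotated]) (simp add: at_le)
qed

lemma convex_difference_quotient_mono:
  fixes \<phi> :: "'a::real_vector \<Rightarrow> real"
  assumes conv: "convex_on UNIV \<phi>" and st: "0 < s" "s \<le> t"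
  shows "(\<phi> (x + s *\<^sub>R d) - \<phi> x) / s \<le> (\<phi> (x + t *\<^sub>R d) - \<phi> x) / t"
proof -
  have eq: "(1 - s / t) *\<^sub>R x + (s / t) *\<^sub>R (x + t *\<^sub>R d) = x + s *\<^sub>R d"
    using st by (simp add: algebra_simps)
  have "\<phi> (x + s *\<^sub>R d) \<le> (1 - s / t) * \<phi> x + (s / t) * \<phi> (x + t *\<^sub>R d)"
    using convex_onD[OF conv, of "s / t" x "x + t *\<^sub>R d"] st by (simp add: eq)
  then have "\<phi> (x + s *\<^sub>R d) - \<phi> x \<le> s * ((\<phi> (x + t *\<^sub>R d) - \<phi> x) / t)"
    by (simp add: algebra_simps diff_divide_distrib)
  then show ?thesis using st by (simp add: divide_le_eq mult.commute)
qed

text \<open>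
  The difference quotients of a convex function decrease as the step shrinks, and a subgradient
  bounds them below, so they converge to their infimum.
\<close>

lemma convex_has_dir_deriv_ge_subgradient:
  fixes \<phi> :: "'a::real_inner \<Rightarrow> real"
  assumes conv: "convex_on UNIV \<phi>" and sub: "\<xi> \<in> subdifferential \<phi> x"
  obtains D where "has_dir_deriv \<phi> x d D" "\<xi> \<bullet> d \<le> D"
proof -
  define q where "q t = (\<phi> (x + t *\<^sub>R d) - \<phi> x) / t" for t
  have lower: "\<xi> \<bullet> d \<le> q t" if "0 < t" for t
  proof -
    have "\<phi> x + \<xi> \<bullet> (x + t *\<^sub>R d - x) \<le> \<phi> (x + t *\<^sub>R d)"
      using sub unfolding subdifferential_def by blast
    then show ?thesis using that by (simp add: q_def field_simps)
  qed
  define D where "D = Inf (q ` {0<..})"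
  have bdd: "bdd_below (q ` {0<..})"
    using lower by (intro bdd_belowI[of _ "\<xi> \<bullet> d"]) auto
  have "(q \<longlongrightarrow> D) (at_right 0)"
  proof (rule order_tendstoI)
    fix a assume "a < D"
    have "a < q t" if "0 < t" for t
      using cInf_lower[OF _ bdd, of "q t"] that \<open>a < D\<close> unfolding D_def by auto
    then show "\<forall>\<^sub>F t in at_right 0. a < q t"
      unfolding eventually_at_right_field by (intro exI[of _ 1]) auto
  next
    fix a assume "D < a"
    then obtain t where t: "0 < t" "q t < a"
      using cInf_less_iff[OF _ bdd, of a] unfolding D_def by auto
    have "q s < a" if "0 < s" "s < t" for s
      using convex_difference_quotient_mono[OF conv, of s t x d] that t(2)
      unfolding q_def by simp
    then show "\<forall>\<^sub>F s in at_right 0. q s < a"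
      unfolding eventually_at_right_field using t(1) by blast
  qed
  moreover have "\<xi> \<bullet> d \<le> D"
    unfolding D_def using lower by (intro cInf_greatest) auto
  ultimately show thesis
    using that unfolding has_dir_deriv_def q_def by blast
qed

text \<open>
  The subgradient inequality bounds the difference quotient of \<open>g\<close> below by \<open>\<xi> \<bullet> d\<close>, bounded
  nonconvexity bounds it above by the same number plus a term of the order of the step.
\<close>

lemma loc_bounded_nonconvex_neg_has_dir_deriv:
  fixes g :: "'a::real_inner \<Rightarrow> real"
  assumes bnc: "loc_bounded_nonconvex_neg g \<rho> x" and sub: "\<xi> \<in> subdifferential g x"
  shows "has_dir_deriv g x d (\<xi> \<bullet> d)"
  unfolding has_dir_deriv_def
proof (rule tendsto_sandwich)
  let ?q = "\<lambda>t. (g (x + t *\<^sub>R d) - g x) / t"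
  let ?b = "\<lambda>t. \<xi> \<bullet> d + t * (\<rho> / 2 * (norm d)\<^sup>2)"
  have "\<xi> \<bullet> d \<le> ?q t" if "0 < t" for t
  proof -
    have "g x + \<xi> \<bullet> (x + t *\<^sub>R d - x) \<le> g (x + t *\<^sub>R d)"
      using sub unfolding subdifferential_def by blast
    then show ?thesis using that by (simp add: field_simps)
  qed
  then show "\<forall>\<^sub>F t in at_right 0. \<xi> \<bullet> d \<le> ?q t"
    unfolding eventually_at_right_field by (intro exI[of _ 1]) auto
  have "?q t \<le> ?b t" if "0 < t" for t
  proof -
    have "- g x \<le> - g (x + t *\<^sub>R d) - (x - (x + t *\<^sub>R d)) \<bullet> \<xi>
        + \<rho> / 2 * (norm (x - (x + t *\<^sub>R d)))\<^sup>2"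
      using bnc sub unfolding loc_bounded_nonconvex_neg_def by blast
    then have "g (x + t *\<^sub>R d) - g x \<le> t * ?b t"
      by (simp add: power_mult_distrib inner_commute algebra_simps power2_eq_square)
    then show ?thesis using that by (simp add: divide_le_eq mult.commute)
  qed
  then show "\<forall>\<^sub>F t in at_right 0. ?q t \<le> ?b t"
    unfolding eventually_at_right_field by (intro exI[of _ 1]) auto
  show "(?b \<longlongrightarrow> \<xi> \<bullet> d) (at_right 0)"
    by (auto intro!: tendsto_eq_intros)
qed simp

section \<open>Subgradient characterisations of the stationarity notions\<close>

text \<open>
  Optimality along an axis constrains only that axis, so the argument is one-dimensional: the
  subgradient inequality for \<open>g\<close> along the axis linearises the concave part of the model, and
  the quadratic terms of the model are those that convexity of \<open>hs i\<close> discards.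
\<close>

lemma coord_stationary_imp_subgradient:
  fixes h :: "real ^ 'n::finite \<Rightarrow> real"
  assumes stat: "x \<in> coord_stationary_points f gradf c hs g \<theta>"
    and h_convex: "convex_on UNIV h"
    and h_separable: "\<And>x. h x = (\<Sum>i\<in>UNIV. hs i (x $ i))"
    and sub: "\<xi> \<in> subdifferential g x"
  shows "\<xi> - gradf x \<in> subdifferential h x"
proof (rule subdifferential_separableI[where h = h and hs = hs, OF h_separable])
  fix i
  show "(\<xi> - gradf x) $ i \<in> subdifferential (hs i) (x $ i)"
  proof (rule subgradient_if_quadratic_lower_bound)
    show "convex_on UNIV (hs i)"
      by (rule convex_on_separable_summand[where h = h, OF h_convex h_separable])
    fix s :: real
    define \<eta> where "\<eta> = s - x $ i"
    have "coord_model f gradf c hs g \<theta> i x 0 \<le> coord_model f gradf c hs g \<theta> i x \<eta>"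
      using stat unfolding coord_stationary_points_def is_arg_min_linorder by blast
    moreover have "g x + \<xi> \<bullet> (x + \<eta> *\<^sub>R axis i 1 - x) \<le> g (x + \<eta> *\<^sub>R axis i 1)"
      using sub unfolding subdifferential_def by blast
    ultimately have "hs i (x $ i) + (\<xi> $ i - gradf x $ i) * \<eta>
        \<le> hs i (x $ i + \<eta>) + ((c $ i + \<theta>) / 2) * \<eta>\<^sup>2"
      by (simp add: coord_model_def inner_axis field_simps)
    then show "hs i (x $ i) + (\<xi> - gradf x) $ i \<bullet> (s - x $ i)
        \<le> hs i s + ((c $ i + \<theta>) / 2) * (norm (s - x $ i))\<^sup>2"
      by (simp add: \<eta>_def)
  qed
qed

text \<open>
  Comparing difference quotients of the four functions uses the limit for \<open>f\<close> and for \<open>F\<close> only: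
  monotonicity of quotients bounds that of \<open>h\<close> by its value at step \<open>1\<close>, and the subgradient
  bounds that of \<open>g\<close>.
\<close>

lemma directional_imp_subgradient:
  fixes f h g F :: "'a::real_inner \<Rightarrow> real"
  assumes dir: "x \<in> directional_points F"
    and f_grad: "GDERIV f x :> D"
    and h_convex: "convex_on UNIV h"
    and F_eq: "\<And>x. F x = f x + h x - g x"
    and sub: "\<xi> \<in> subdifferential g x"
  shows "\<xi> - D \<in> subdifferential h x"
proof -
  have "h x + (\<xi> - D) \<bullet> (y - x) \<le> h y" for y
  proof -
    define d where "d = y - x"
    obtain L where L: "has_dir_deriv F x d L" "0 \<le> L"
      using dir unfolding directional_points_def d_def by blast
    let ?b = "\<lambda>t. (f (x + t *\<^sub>R d) - f x) / t + (h y - h x - \<xi> \<bullet> d)"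
    have "(F (x + t *\<^sub>R d) - F x) / t \<le> ?b t" if t: "0 < t" "t < 1" for t
    proof -
      have "(h (x + t *\<^sub>R d) - h x) / t \<le> h y - h x"
        using convex_difference_quotient_mono[OF h_convex, of t 1 x d] t by (simp add: d_def)
      moreover have "\<xi> \<bullet> d \<le> (g (x + t *\<^sub>R d) - g x) / t"
      proof -
        have "g x + \<xi> \<bullet> (x + t *\<^sub>R d - x) \<le> g (x + t *\<^sub>R d)"
          using sub unfolding subdifferential_def by blast
        then show ?thesis using t by (simp add: field_simps)
      qed
      ultimately show ?thesis
        by (simp add: F_eq add_divide_distrib diff_divide_distrib)
    qed
    then have ev: "\<forall>\<^sub>F t in at_right 0. (F (x + t *\<^sub>R d) - F x) / t \<le> ?b t"
      unfolding eventually_at_right_field by (intro exI[of _ 1]) auto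
    have "(?b \<longlongrightarrow> D \<bullet> d + (h y - h x - \<xi> \<bullet> d)) (at_right 0)"
      using has_dir_deriv_GDERIV[OF f_grad, of d] unfolding has_dir_deriv_def
      by (intro tendsto_add tendsto_const)
    then have "L \<le> D \<bullet> d + (h y - h x - \<xi> \<bullet> d)"
      using L(1) ev unfolding has_dir_deriv_def by (intro tendsto_le) auto
    then show ?thesis
      using L(2) by (simp add: d_def inner_diff_left)
  qed
  then show ?thesis by (simp add: subdifferential_def)
qed

section \<open>The hierarchy\<close>

theorem theorem5p8:
  fixes f h g F :: "real ^ 'n::finite \<Rightarrow> real"
    and gradf :: "real ^ 'n \<Rightarrow> real ^ 'n"
    and hs :: "'n \<Rightarrow> real \<Rightarrow> real"
    and c :: "real ^ 'n"
    and \<theta> \<rho> :: real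
  assumes f_convex: "convex_on UNIV f"
    and f_grad: "\<And>x. GDERIV f x :> gradf x"
    and gradf_cont: "continuous_on UNIV gradf"
    and c_nonneg: "\<And>i. c $ i \<ge> 0"
    and f_coord_smooth: "\<And>x \<eta> i. f (x + \<eta> *\<^sub>R axis i 1)
          \<le> f x + gradf x \<bullet> (\<eta> *\<^sub>R axis i 1) + c $ i / 2 * \<eta>\<^sup>2"
    and h_convex: "convex_on UNIV h"
    and h_separable: "\<And>x. h x = (\<Sum>i\<in>UNIV. hs i (x $ i))"
    and g_convex: "convex_on UNIV g"
    and subproblem_solvable: "\<And>x i. \<exists>\<eta>.
          is_arg_min (subproblem hs g (c $ i + \<theta>) (gradf x $ i) x i) (\<lambda>_. True) \<eta>"
    and F_eq: "\<And>x. F x = f x + h x - g x"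
    and theta_nonneg: "\<theta> \<ge> 0"
    and bounded_nonconvex: "\<And>x. x \<in> coord_stationary_points f gradf c hs g \<theta>
          \<Longrightarrow> loc_bounded_nonconvex_neg g \<rho> x"
  shows "optimal_points F \<subseteq> coord_stationary_points f gradf c hs g \<theta>
    \<and> coord_stationary_points f gradf c hs g \<theta> \<subseteq> directional_points F
    \<and> directional_points F \<subseteq> critical_points gradf h g"
proof (intro conjI subsetI)
  fix x assume opt: "x \<in> optimal_points F"
  have "coord_model f gradf c hs g \<theta> i x 0 \<le> coord_model f gradf c hs g \<theta> i x \<eta>" for i \<eta>
  proof -
    have "F x \<le> F (x + \<eta> *\<^sub>R axis i 1)"
      using opt by (simp add: optimal_points_def is_arg_min_linorder)
    moreover have "0 \<le> \<theta> / 2 * \<eta>\<^sup>2"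
      using theta_nonneg by simp
    ultimately show ?thesis
      using f_coord_smooth[of x \<eta> i]
      by (simp add: coord_model_def F_eq separable_coordinate_step[where h = h and hs = hs, OF h_separable])
  qed
  then show "x \<in> coord_stationary_points f gradf c hs g \<theta>"
    by (simp add: coord_stationary_points_def is_arg_min_linorder)
next
  fix x assume stat: "x \<in> coord_stationary_points f gradf c hs g \<theta>"
  obtain \<xi> where \<xi>: "\<xi> \<in> subdifferential g x"
    using subdifferential_nonempty[OF g_convex] by blast
  have "\<exists>D. has_dir_deriv F x (y - x) D \<and> D \<ge> 0" for y
  proof -
    obtain H where H: "has_dir_deriv h x (y - x) H" "(\<xi> - gradf x) \<bullet> (y - x) \<le> H"
      using convex_has_dir_deriv_ge_subgradient[OF h_convex
        coord_stationary_imp_subgradient[where h = h, OF stat h_convex h_separable \<xi>]] by blast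
    have "F = (\<lambda>y. f y + h y - g y)"
      using F_eq by blast
    then have "has_dir_deriv F x (y - x) (gradf x \<bullet> (y - x) + H - \<xi> \<bullet> (y - x))"
      using has_dir_deriv_diff[OF has_dir_deriv_add[OF has_dir_deriv_GDERIV[OF f_grad] H(1)]
        loc_bounded_nonconvex_neg_has_dir_deriv[OF bounded_nonconvex[OF stat] \<xi>]] by simp
    then show ?thesis
      using H(2) by (auto simp: inner_diff_left)
  qed
  then show "x \<in> directional_points F"
    by (simp add: directional_points_def)
next
  fix x assume dir: "x \<in> directional_points F"
  obtain \<xi> where \<xi>: "\<xi> \<in> subdifferential g x"
    using subdifferential_nonempty[OF g_convex] by blast
  have "\<xi> - gradf x \<in> subdifferential h x"
    by (rule directional_imp_subgradient[OF dir f_grad h_convex F_eq \<xi>])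
  moreover have "0 = gradf x + (\<xi> - gradf x) - \<xi>"
    by simp
  ultimately show "x \<in> critical_points gradf h g"
    using \<xi> unfolding critical_points_def by blast
qed

end
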